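(* Let $f=t_1+\cdots+t_s+g_{11}\cdots g_{1m_1}+\cdots+g_{l1}\cdots g_{lm_l}\in\mathbb{R}[x_1,\dots,x_n]$ be a summand-reduced polynomial, and let $p_{ji}$ be the number of monomials in $g_{ji}$. Then the refined algorithm produces matrix factors of $f$ whose size is $$2^{\sum_{j=1}^{l}m_j-l}$$ times smaller than the size one obtains with the improved algorithm; that is, the size produced by the improved algorithm equals $2^{\sum_{j=1}^{l}m_j-l}$ times the size produced by the refined algorithm.
   Context: Let $S=\mathbb{R}[x_1,\dots,x_n]$. A matrix factorization of size $N$ of $f\in S$ is a pair $(\phi,\psi)$ of $N\times N$ matrices over $S$ (its matrix factors) with $\phi\psi=\psi\phi=fI_N$. Summand-reduced polynomials. $f$ is summand-reduced if it is written in the form $f=t_1+\cdots+t_s+g_{11}\cdots g_{1m_1}+\cdots+g_{l1}\cdots g_{lm_l}$, where: (1) if $s=0$ there are at least two products $g_{11}\cdots g_{1m_1}$, $g_{21}\cdots g_{2m_2}$ in $f$; if $s\neq0$ there is at least one product $g_{11}\cdots g_{1m_1}$ in $f$; (2) each $t_i$ is a monomial, so $t_i=h_{i1}h_{i2}$ where $h_{i1},h_{i2}$ are products of variables possibly raised to some power; (3) for each $j=1,\dots,l$, $g_{j1}\cdots g_{jm_j}$ is a product of sums of monomials which, if expanded, would have more monomials than the number that appears in the factor form $g_{j1}\cdots g_{jm_j}$; (4) at least one of the products $g_{j1}\cdots g_{jm_j}$ has at least two factors. Standard method. For a polynomial $f_k=a_1b_1+\cdots+a_kb_k$ written as a sum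 of $k$ monomials $a_ib_i$: start with the $1\times1$ factorization $([a_1],[b_1])$; given a factorization $(C,D)$ of size $N$ of $f_{i-1}=a_1b_1+\cdots+a_{i-1}b_{i-1}$, take $$\left(\begin{bmatrix}C&-a_iI_N\\ b_iI_N&D\end{bmatrix},\begin{bmatrix}D&a_iI_N\\-b_iI_N&C\end{bmatrix}\right)$$ as a factorization of size $2N$ of $f_i$. A sum of $k$ monomials thus gets a factorization of size $2^{k-1}$. Tensor products. For matrix factorizations $X=(\phi,\psi)$ of $u\in S$ of size $a$ and $X'=(\phi',\psi')$ of $v\in S$ of size $b$, with $\otimes$ the Kronecker product: Yoshino tensor product (a factorization of $u+v$ of size $2ab$): $$X\,\widehat{\otimes}\,X'=\left(\begin{bmatrix}\phi\otimes 1_b&1_a\otimes\phi'\\-1_a\otimes\psi'&\psi\otimes1_b\end{bmatrix},\begin{bmatrix}\psi\otimes1_b&-1_a\otimes\phi'\\1_a\otimes\psi'&\phi\otimes1_b\end{bmatrix}\right);$$ multiplicative tensor product: $X\,\widetilde{\otimes}\,X'=\big((\phi\otimes\phi')\oplus(\phi\otimes\phi'),\,(\psi\otimes\psi')\oplus(\psi\otimes\psi')\big)$, where $\oplus$ is the block-diagonal sum; refined multiplicative tensor product: $X\,\overline{\otimes}\,X'=(\phi\otimes\phi',\psi\otimes\psi')$. Refined algorithm (for $f$ summand-reduced): (i) apply the standard method to each $g_{ji}$ (a sum of $p_{ji}$ monomials); (ii) for each $j$, combine the resulting factorizations of $g_{j1},\dots,g_{jm_j}$ successively with $\overline{\otimes}$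 to get a factorization of $g_{j1}\cdots g_{jm_j}$; (iii) combine these over $j=1,\dots,l$ successively with $\widehat{\otimes}$ to get a factorization $(C,D)$ of $g_{11}\cdots g_{1m_1}+\cdots+g_{l1}\cdots g_{lm_l}$; (iv) if $s=0$, output $(C,D)$; otherwise apply the standard method to $t_1+\cdots+t_s$ to get $(A,B)$, and output $(A,B)\,\widehat{\otimes}\,(C,D)$. Improved algorithm: the same procedure with $\overline{\otimes}$ replaced by $\widetilde{\otimes}$ in step (ii). *)

theory Defs
  imports "HOL-Library.Poly_Mapping" "Jordan_Normal_Form.Matrix"
begin

text \<open>
  \<open>'n mpoly\<close> is the polynomial ring over the reals in the variables \<open>x\<^sub>i\<close>, \<open>i :: 'n\<close>; for a
  finite type \<open>'n\<close> with \<open>n\<close> elements it is \<open>\<real>[x\<^sub>1,\<dots>,x\<^sub>n]\<close>.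
\<close>

type_synonym 'n mpoly = "('n \<Rightarrow>\<^sub>0 nat) \<Rightarrow>\<^sub>0 real"

text \<open>Any nonzero real coefficient is allowed in a monomial; \<open>c = 1\<close> gives the pure products of
  powers of variables.\<close>

definition is_monomial :: "'n mpoly \<Rightarrow> bool" where
  "is_monomial t \<longleftrightarrow> (\<exists>\<alpha> c. c \<noteq> 0 \<and> t = Poly_Mapping.single \<alpha> c)"


subsection \<open>Matrix factorizations\<close>

type_synonym 'a mat_pair = "'a mat \<times> 'a mat"

definition matrix_factorization :: "'a :: comm_ring_1 \<Rightarrow> nat \<Rightarrow> 'a mat_pair \<Rightarrow> bool" where
  "matrix_factorization f N X \<longleftrightarrow>
     fst X \<in> carrier_mat N N \<and> snd X \<in> carrier_mat N N \<and>
     fst X * snd X = f \<cdot>\<^sub>m 1\<^sub>m N \<and> snd X * fst X = f \<cdot>\<^sub>m 1\<^sub>m N"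

definition mf_size :: "'a mat_pair \<Rightarrow> nat" where
  "mf_size X = dim_row (fst X)"

definition kronecker :: "'a :: times mat \<Rightarrow> 'a mat \<Rightarrow> 'a mat" (infixl \<open>\<otimes>\<^sub>K\<close> 70) where
  "A \<otimes>\<^sub>K B = mat (dim_row A * dim_row B) (dim_col A * dim_col B)
     (\<lambda>(i, j). A $$ (i div dim_row B, j div dim_col B) * B $$ (i mod dim_row B, j mod dim_col B))"

definition yoshino_tensor :: "'a :: comm_ring_1 mat_pair \<Rightarrow> 'a mat_pair \<Rightarrow> 'a mat_pair" where
  "yoshino_tensor X X' =
     (let \<phi> = fst X; \<psi> = snd X; \<phi>' = fst X'; \<psi>' = snd X'; a = mf_size X; b = mf_size X'
      in (four_block_mat (\<phi> \<otimes>\<^sub>K 1\<^sub>m b)        (1\<^sub>m a \<otimes>\<^sub>K \<phi>')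
                         (- (1\<^sub>m a \<otimes>\<^sub>K \<psi>'))    (\<psi> \<otimes>\<^sub>K 1\<^sub>m b),
          four_block_mat (\<psi> \<otimes>\<^sub>K 1\<^sub>m b)        (- (1\<^sub>m a \<otimes>\<^sub>K \<phi>'))
                         (1\<^sub>m a \<otimes>\<^sub>K \<psi>')        (\<phi> \<otimes>\<^sub>K 1\<^sub>m b)))"

definition mult_tensor :: "'a :: comm_ring_1 mat_pair \<Rightarrow> 'a mat_pair \<Rightarrow> 'a mat_pair" where
  "mult_tensor X X' =
     (diag_block_mat [fst X \<otimes>\<^sub>K fst X', fst X \<otimes>\<^sub>K fst X'],
      diag_block_mat [snd X \<otimes>\<^sub>K snd X', snd X \<otimes>\<^sub>K snd X'])"

definition refined_mult_tensor :: "'a :: comm_ring_1 mat_pair \<Rightarrow> 'a mat_pair \<Rightarrow> 'a mat_pair" where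
  "refined_mult_tensor X X' = (fst X \<otimes>\<^sub>K fst X', snd X \<otimes>\<^sub>K snd X')"


subsection \<open>The standard method\<close>

text \<open>
  The input \<open>a\<^sub>1 b\<^sub>1 + \<dots> + a\<^sub>k b\<^sub>k\<close> is the nonempty list of the pairs \<open>(a\<^sub>i, b\<^sub>i)\<close>: the
  method depends on how each monomial is split into two factors.
\<close>

definition standard_step :: "'a :: comm_ring_1 mat_pair \<Rightarrow> 'a \<times> 'a \<Rightarrow> 'a mat_pair" where
  "standard_step X t =
     (let C = fst X; D = snd X; a = fst t; b = snd t; N = mf_size X
      in (four_block_mat C (- a \<cdot>\<^sub>m 1\<^sub>m N) (b \<cdot>\<^sub>m 1\<^sub>m N) D,
          four_block_mat D (a \<cdot>\<^sub>m 1\<^sub>m N) (- b \<cdot>\<^sub>m 1\<^sub>m N) C))"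

definition standard_method :: "('a :: comm_ring_1 \<times> 'a) list \<Rightarrow> 'a mat_pair" where
  "standard_method ts =
     foldl standard_step (mat 1 1 (\<lambda>_. fst (hd ts)), mat 1 1 (\<lambda>_. snd (hd ts))) (tl ts)"


subsection \<open>Summand-reduced polynomials\<close>

text \<open>
  Being summand-reduced is a property of a way of writing \<open>f\<close>, which is recorded as follows.
  A sum of monomials is a list of split monomials, as above. The list \<open>ts\<close> is
  \<open>t\<^sub>1 + \<dots> + t\<^sub>s\<close>. The \<open>j\<close>-th entry of \<open>gs\<close> is the list of the factors of the \<open>j\<close>-th product,
  each factor again being a sum of monomials. So \<open>s = length ts\<close>, \<open>l = length gs\<close>,
  \<open>m\<^sub>j = length (gs ! j)\<close> and \<open>p\<^sub>j\<^sub>i = length (gs ! j ! i)\<close> (with indices from \<open>0\<close>).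
\<close>

type_synonym 'n split_sum = "('n mpoly \<times> 'n mpoly) list"

definition split_sum_poly :: "'n split_sum \<Rightarrow> 'n mpoly" where
  "split_sum_poly ts = (\<Sum>(a, b)\<leftarrow>ts. a * b)"

definition product_poly :: "'n split_sum list \<Rightarrow> 'n mpoly" where
  "product_poly g = (\<Prod>h\<leftarrow>g. split_sum_poly h)"

definition is_split_sum :: "'n split_sum \<Rightarrow> bool" where
  "is_split_sum ts \<longleftrightarrow> (\<forall>(a, b)\<in>set ts. is_monomial a \<and> is_monomial b)"

text \<open>
  The third conjunct is implicit in the notation \<open>g\<^sub>j\<^sub>1 \<dots> g\<^sub>j\<^sub>m\<close>: there is at least one factor, and
  each factor is a sum of at least one monomial. In the sixth conjunct the cardinality counts the
  monomials of the expanded product after like terms are collected, and the right-hand side is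
  \<open>p\<^sub>j\<^sub>1 + \<dots> + p\<^sub>j\<^sub>m\<close>, the number of monomials written down in the factored form.
\<close>

definition summand_reduced :: "'n mpoly \<Rightarrow> 'n split_sum \<Rightarrow> 'n split_sum list list \<Rightarrow> bool" where
  "summand_reduced f ts gs \<longleftrightarrow>
     f = split_sum_poly ts + (\<Sum>g\<leftarrow>gs. product_poly g) \<and>
     (if ts = [] then length gs \<ge> 2 else length gs \<ge> 1) \<and>
     (\<forall>g\<in>set gs. g \<noteq> [] \<and> (\<forall>h\<in>set g. h \<noteq> [])) \<and>
     is_split_sum ts \<and>
     (\<forall>g\<in>set gs. \<forall>h\<in>set g. is_split_sum h) \<and>
     (\<forall>g\<in>set gs. card (Poly_Mapping.keys (product_poly g)) > (\<Sum>h\<leftarrow>g. length h)) \<and>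
     (\<exists>g\<in>set gs. length g \<ge> 2)"


subsection \<open>The refined and the improved algorithm\<close>

definition combine :: "('a \<Rightarrow> 'a \<Rightarrow> 'a) \<Rightarrow> 'a list \<Rightarrow> 'a" where
  "combine op Xs = foldl op (hd Xs) (tl Xs)"

definition factorization_algorithm ::
    "('n mpoly mat_pair \<Rightarrow> 'n mpoly mat_pair \<Rightarrow> 'n mpoly mat_pair) \<Rightarrow>
     'n split_sum \<Rightarrow> 'n split_sum list list \<Rightarrow> 'n mpoly mat_pair" where
  "factorization_algorithm op ts gs =
     (let CD = combine yoshino_tensor (map (\<lambda>g. combine op (map standard_method g)) gs)
      in if ts = [] then CD else yoshino_tensor (standard_method ts) CD)"

definition refined_algorithm :: "'n split_sum \<Rightarrow> 'n split_sum list list \<Rightarrow> 'n mpoly mat_pair" where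
  "refined_algorithm = factorization_algorithm refined_mult_tensor"

definition improved_algorithm :: "'n split_sum \<Rightarrow> 'n split_sum list list \<Rightarrow> 'n mpoly mat_pair" where
  "improved_algorithm = factorization_algorithm mult_tensor"

end

theory Submission
  imports Defs
begin

text \<open>
  By the mixed-product rule \<open>(A \<otimes> B) (C \<otimes> D) = A C \<otimes> B D\<close>, factorizations of sizes \<open>a\<close> and \<open>b\<close>
  combine to one of size \<open>2 a b\<close> under the Yoshino and the multiplicative tensor product, and to one
  of size \<open>a b\<close> under the refined one. So the two algorithms differ by one factor \<open>2\<close> for each of the
  \<open>m\<^sub>j - 1\<close> multiplications in the \<open>j\<close>-th product, and \<open>\<Sum>\<^sub>j (m\<^sub>j - 1) = \<Sum>\<^sub>j m\<^sub>j - l\<close> because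
  every \<open>m\<^sub>j\<close> is at least \<open>1\<close>.
\<close>

section \<open>Kronecker products\<close>

text \<open>The map \<open>k \<mapsto> (k div m, k mod m)\<close> is a bijection from the indices
  below \<open>n * m\<close> to pairs of indices. The induction splits off the last block of
  \<open>m\<close> indices.\<close>

lemma sum_div_mod_mult:
  fixes f g :: "nat \<Rightarrow> 'a :: comm_semiring_0"
  shows "(\<Sum>k<n * m. f (k div m) * g (k mod m)) = (\<Sum>i<n. f i) * (\<Sum>j<m. g j)"
proof (induction n)
  case (Suc n)
  \<comment> \<open>The lower bound \<open>0 + n * m\<close> has the shape that the shift rule
    expects. After the shift, every index of the block has quotient \<open>n\<close>.\<close>
  have "(\<Sum>k<Suc n * m. f (k div m) * g (k mod m))
      = (\<Sum>k<n * m. f (k div m) * g (k mod m)) + (\<Sum>k=0 + n * m..<m + n * m. f (k div m) * g (k mod m))"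
    by (simp only: mult_Suc lessThan_atLeast0 add_0 sum.atLeastLessThan_concat[of 0 "n * m" "m + n * m"] le0 le_add2)
  also have "(\<Sum>k=0 + n * m..<m + n * m. f (k div m) * g (k mod m)) = (\<Sum>j<m. f n * g j)"
    unfolding sum.shift_bounds_nat_ivl lessThan_atLeast0 by (rule sum.cong) simp_all
  finally show ?case
    using Suc.IH by (simp add: distrib_right flip: sum_distrib_left)
qed simp

lemma dim_kronecker [simp]:
  "dim_row (A \<otimes>\<^sub>K B) = dim_row A * dim_row B"
  "dim_col (A \<otimes>\<^sub>K B) = dim_col A * dim_col B"
  by (simp_all add: kronecker_def)

lemma index_kronecker:
  "i < dim_row A * dim_row B \<Longrightarrow> j < dim_col A * dim_col B \<Longrightarrow> (A \<otimes>\<^sub>K B) $$ (i, j)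
    = A $$ (i div dim_row B, j div dim_col B) * B $$ (i mod dim_row B, j mod dim_col B)"
  by (simp add: kronecker_def)

lemma kronecker_carrier [simp]:
  "A \<in> carrier_mat m n \<Longrightarrow> B \<in> carrier_mat p q \<Longrightarrow> A \<otimes>\<^sub>K B \<in> carrier_mat (m * p) (n * q)"
  by (rule carrier_matI) (simp_all only: dim_kronecker carrier_matD)

text \<open>The mixed-product rule: the summation index below \<open>n * q\<close> encodes a pair of
  indices, one for each ordinary product, so the double sum factors.\<close>

lemma kronecker_mult:
  fixes A B C D :: "'a :: comm_semiring_0 mat"
  assumes "A \<in> carrier_mat m n" "C \<in> carrier_mat n r"
    and "B \<in> carrier_mat p q" "D \<in> carrier_mat q s"
  shows "(A \<otimes>\<^sub>K B) * (C \<otimes>\<^sub>K D) = (A * C) \<otimes>\<^sub>K (B * D)"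
proof (rule eq_matI)
  fix i j
  assume "i < dim_row ((A * C) \<otimes>\<^sub>K (B * D))" "j < dim_col ((A * C) \<otimes>\<^sub>K (B * D))"
  then have ij: "i < m * p" "j < r * s"
    using assms by auto
  \<comment> \<open>An index in range forces positive inner dimensions, without which the remainders
    would have no bound.\<close>
  then have pos: "0 < p" "0 < s"
    by (auto intro: gr0I)
  have idx: "i div p < m" "i mod p < p" "j div s < r" "j mod s < s"
    using ij pos by (simp_all add: less_mult_imp_div_less)
  have dims: "dim_row A = m" "dim_col A = n" "dim_row B = p" "dim_col B = q"
    "dim_row C = n" "dim_col C = r" "dim_row D = q" "dim_col D = s"
    using assms by simp_all
  \<comment> \<open>This replaces \<open>index_mult_mat(1)\<close>, so that entries become plain
    sums and not scalar products of rows and columns.\<close>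
  have prod: "(X * Y) $$ (i', j') = (\<Sum>k<dim_row Y. X $$ (i', k) * Y $$ (k, j'))"
    if "i' < dim_row X" "j' < dim_col Y" "dim_col X = dim_row Y" for X Y :: "'a mat" and i' j'
    using that by (simp add: scalar_prod_def lessThan_atLeast0)
  have "((A \<otimes>\<^sub>K B) * (C \<otimes>\<^sub>K D)) $$ (i, j)
      = (\<Sum>k<n * q. (A \<otimes>\<^sub>K B) $$ (i, k) * (C \<otimes>\<^sub>K D) $$ (k, j))"
    by (subst prod) (simp_all add: dims ij del: index_mult_mat(1))
  also have "\<dots> = (\<Sum>k<n * q. (A $$ (i div p, k div q) * C $$ (k div q, j div s))
          * (B $$ (i mod p, k mod q) * D $$ (k mod q, j mod s)))"
    by (rule sum.cong) (simp_all add: index_kronecker dims ij mult_ac)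
  also have "\<dots> = (\<Sum>k<n. A $$ (i div p, k) * C $$ (k, j div s))
      * (\<Sum>k<q. B $$ (i mod p, k) * D $$ (k, j mod s))"
    by (rule sum_div_mod_mult)
  also have "\<dots> = (A * C) $$ (i div p, j div s) * (B * D) $$ (i mod p, j mod s)"
    using idx by (simp add: prod dims del: index_mult_mat(1))
  also have "\<dots> = ((A * C) \<otimes>\<^sub>K (B * D)) $$ (i, j)"
    by (simp add: index_kronecker dims ij)
  finally show "((A \<otimes>\<^sub>K B) * (C \<otimes>\<^sub>K D)) $$ (i, j) = ((A * C) \<otimes>\<^sub>K (B * D)) $$ (i, j)" .
qed (use assms in simp_all)

text \<open>Quotient and remainder by \<open>b\<close> determine an index, so being on both small
  diagonals means being on the large one.\<close>

lemma kronecker_smult_one: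
  fixes u v :: "'a :: comm_semiring_1"
  shows "(u \<cdot>\<^sub>m 1\<^sub>m a) \<otimes>\<^sub>K (v \<cdot>\<^sub>m 1\<^sub>m b) = (u * v) \<cdot>\<^sub>m 1\<^sub>m (a * b)"
proof (rule eq_matI)
  fix i j
  assume "i < dim_row ((u * v) \<cdot>\<^sub>m 1\<^sub>m (a * b) :: 'a mat)" "j < dim_col ((u * v) \<cdot>\<^sub>m 1\<^sub>m (a * b) :: 'a mat)"
  then have ij: "i < a * b" "j < a * b"
    by auto
  then have "0 < b"
    by (auto intro: gr0I)
  then have "i div b < a" "j div b < a" "i mod b < b" "j mod b < b"
    using ij by (simp_all add: less_mult_imp_div_less)
  then have "((u \<cdot>\<^sub>m 1\<^sub>m a) \<otimes>\<^sub>K (v \<cdot>\<^sub>m 1\<^sub>m b)) $$ (i, j)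
      = (if i div b = j div b \<and> i mod b = j mod b then u * v else 0)"
    using ij by (auto simp: index_kronecker)
  also have "i div b = j div b \<and> i mod b = j mod b \<longleftrightarrow> i = j"
    using div_mult_mod_eq[of i b] div_mult_mod_eq[of j b] by metis
  finally show "((u \<cdot>\<^sub>m 1\<^sub>m a) \<otimes>\<^sub>K (v \<cdot>\<^sub>m 1\<^sub>m b)) $$ (i, j) = ((u * v) \<cdot>\<^sub>m 1\<^sub>m (a * b)) $$ (i, j)"
    using ij by simp
qed simp_all


section \<open>Elementary constructions of matrix factorizations\<close>

lemma one_smult_mat [simp]: "(1 :: 'a :: monoid_mult) \<cdot>\<^sub>m A = A"
  by (rule eq_matI) auto

lemma matrix_factorization_size: "matrix_factorization f N X \<Longrightarrow> mf_size X = N"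
  by (auto simp: matrix_factorization_def mf_size_def)

lemma four_block_smult_one:
  fixes u :: "'a :: semiring_1"
  shows "four_block_mat (u \<cdot>\<^sub>m 1\<^sub>m m) (0\<^sub>m m n) (0\<^sub>m n m) (u \<cdot>\<^sub>m 1\<^sub>m n) = u \<cdot>\<^sub>m 1\<^sub>m (m + n)"
  by (rule eq_matI) auto

text \<open>The scalar blocks commute with \<open>C\<close> and \<open>D\<close>, so with opposite
  signs the off-diagonal blocks cancel, while each diagonal block gains
  \<open>a * b\<close>.\<close>

lemma matrix_factorization_standard_step:
  fixes f a b :: "'a :: comm_ring_1"
  assumes "matrix_factorization f N X"
  shows "matrix_factorization (f + a * b) (2 * N) (standard_step X (a, b))"
proof -
  obtain C D where X: "X = (C, D)" by fastforce
  note size = matrix_factorization_size[OF assms]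
  have C: "C \<in> carrier_mat N N" and D: "D \<in> carrier_mat N N"
    and CD: "C * D = f \<cdot>\<^sub>m 1\<^sub>m N" and DC: "D * C = f \<cdot>\<^sub>m 1\<^sub>m N"
    using assms by (auto simp: matrix_factorization_def X)
  have s: "c \<cdot>\<^sub>m 1\<^sub>m N \<in> carrier_mat N N" for c :: 'a by simp
  have smult: "A * (c \<cdot>\<^sub>m 1\<^sub>m N) = c \<cdot>\<^sub>m A" "(c \<cdot>\<^sub>m 1\<^sub>m N) * A = c \<cdot>\<^sub>m A"
    if "A \<in> carrier_mat N N" for A and c :: 'a
    using that by (simp_all add: mult_smult_distrib[of A N N _ N] mult_smult_assoc_mat[of _ N N])
  have "four_block_mat C (- a \<cdot>\<^sub>m 1\<^sub>m N) (b \<cdot>\<^sub>m 1\<^sub>m N) D * four_block_mat D (a \<cdot>\<^sub>m 1\<^sub>m N) (- b \<cdot>\<^sub>m 1\<^sub>m N) C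
      = four_block_mat ((f + a * b) \<cdot>\<^sub>m 1\<^sub>m N) (0\<^sub>m N N) (0\<^sub>m N N) ((f + a * b) \<cdot>\<^sub>m 1\<^sub>m N)"
    \<comment> \<open>The carrier facts run through the blocks of the left factor, then of the right
      factor, row by row.\<close>
    by (subst mult_four_block_mat[OF C s s D D s s C])
      (intro cong_four_block_mat; rule eq_matI;
        use C D in \<open>auto simp: smult CD DC algebra_simps\<close>)
  moreover have "four_block_mat D (a \<cdot>\<^sub>m 1\<^sub>m N) (- b \<cdot>\<^sub>m 1\<^sub>m N) C * four_block_mat C (- a \<cdot>\<^sub>m 1\<^sub>m N) (b \<cdot>\<^sub>m 1\<^sub>m N) D
      = four_block_mat ((f + a * b) \<cdot>\<^sub>m 1\<^sub>m N) (0\<^sub>m N N) (0\<^sub>m N N) ((f + a * b) \<cdot>\<^sub>m 1\<^sub>m N)"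
    by (subst mult_four_block_mat[OF D s s C C s s D])
      (intro cong_four_block_mat; rule eq_matI;
        use C D in \<open>auto simp: smult CD DC algebra_simps\<close>)
  ultimately show ?thesis
    using C D size by (simp add: matrix_factorization_def standard_step_def X Let_def
        four_block_smult_one mult_2)
qed

text \<open>The same cancellation as in the standard step, with blocks that commute because each
  acts on only one tensor factor.\<close>

lemma matrix_factorization_yoshino_tensor:
  fixes u v :: "'a :: comm_ring_1"
  assumes "matrix_factorization u a X" "matrix_factorization v b Y"
  shows "matrix_factorization (u + v) (2 * a * b) (yoshino_tensor X Y)"
proof -
  obtain \<phi> \<psi> where X: "X = (\<phi>, \<psi>)" by fastforce
  obtain \<phi>' \<psi>' where Y: "Y = (\<phi>', \<psi>')" by fastforce
  note size = assms[THEN matrix_factorization_size]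
  have c: "\<phi> \<in> carrier_mat a a" "\<psi> \<in> carrier_mat a a" "\<phi>' \<in> carrier_mat b b" "\<psi>' \<in> carrier_mat b b"
    and eq: "\<phi> * \<psi> = u \<cdot>\<^sub>m 1\<^sub>m a" "\<psi> * \<phi> = u \<cdot>\<^sub>m 1\<^sub>m a"
      "\<phi>' * \<psi>' = v \<cdot>\<^sub>m 1\<^sub>m b" "\<psi>' * \<phi>' = v \<cdot>\<^sub>m 1\<^sub>m b"
    using assms by (auto simp: matrix_factorization_def X Y)
  define P Q R S where defs: "P = \<phi> \<otimes>\<^sub>K 1\<^sub>m b" "Q = 1\<^sub>m a \<otimes>\<^sub>K \<phi>'" "R = 1\<^sub>m a \<otimes>\<^sub>K \<psi>'" "S = \<psi> \<otimes>\<^sub>K 1\<^sub>m b"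
  have K: "P \<in> carrier_mat (a * b) (a * b)" "Q \<in> carrier_mat (a * b) (a * b)"
    "R \<in> carrier_mat (a * b) (a * b)" "S \<in> carrier_mat (a * b) (a * b)"
    using c by (simp_all add: defs)
  have N: "- Q \<in> carrier_mat (a * b) (a * b)" "- R \<in> carrier_mat (a * b) (a * b)"
    using K by simp_all
  \<comment> \<open>By the mixed-product rule both orders give the same Kronecker product; for
    \<open>P\<close> and \<open>Q\<close> it is
    \<open>\<phi> \<otimes>\<^sub>K \<phi>'\<close>.\<close>
  have comm: "P * Q = Q * P" "R * S = S * R" "S * Q = Q * S" "R * P = P * R"
    using c by (simp_all add: defs kronecker_mult[of _ a a _ a _ b b _ b])
  \<comment> \<open>These are the cases of \<open>kronecker_smult_one\<close> in which one of the
    scalars is \<open>1\<close>.\<close>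
  have one: "P * S = u \<cdot>\<^sub>m 1\<^sub>m (a * b)" "S * P = u \<cdot>\<^sub>m 1\<^sub>m (a * b)"
    "Q * R = v \<cdot>\<^sub>m 1\<^sub>m (a * b)" "R * Q = v \<cdot>\<^sub>m 1\<^sub>m (a * b)"
    using c kronecker_smult_one[of u a 1 b] kronecker_smult_one[of 1 a v b]
    by (simp_all add: defs eq kronecker_mult[of _ a a _ a _ b b _ b])
  have uminus: "(- A) * B = - (A * B)" "A * (- B) = - (A * B)"
    if "A \<in> carrier_mat (a * b) (a * b)" "B \<in> carrier_mat (a * b) (a * b)" for A B :: "'a mat"
    using that by simp_all
  have "four_block_mat P Q (- R) S * four_block_mat S (- Q) R P
      = four_block_mat ((u + v) \<cdot>\<^sub>m 1\<^sub>m (a * b)) (0\<^sub>m (a * b) (a * b)) (0\<^sub>m (a * b) (a * b)) ((u + v) \<cdot>\<^sub>m 1\<^sub>m (a * b))"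
    by (subst mult_four_block_mat[OF K(1,2) N(2) K(4,4) N(1) K(3,1)])
      (intro cong_four_block_mat; rule eq_matI;
        use K in \<open>auto simp: uminus comm one algebra_simps\<close>)
  moreover have "four_block_mat S (- Q) R P * four_block_mat P Q (- R) S
      = four_block_mat ((u + v) \<cdot>\<^sub>m 1\<^sub>m (a * b)) (0\<^sub>m (a * b) (a * b)) (0\<^sub>m (a * b) (a * b)) ((u + v) \<cdot>\<^sub>m 1\<^sub>m (a * b))"
    by (subst mult_four_block_mat[OF K(4) N(1) K(3,1,1,2) N(2) K(4)])
      (intro cong_four_block_mat; rule eq_matI;
        use K in \<open>auto simp: uminus comm one algebra_simps\<close>)
  ultimately show ?thesis
    using K size by (simp add: matrix_factorization_def yoshino_tensor_def X Y Let_def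
        four_block_smult_one mult_2 distrib_right flip: defs)
qed

lemma matrix_factorization_refined_mult_tensor:
  fixes u v :: "'a :: comm_ring_1"
  assumes "matrix_factorization u a X" "matrix_factorization v b Y"
  shows "matrix_factorization (u * v) (a * b) (refined_mult_tensor X Y)"
  using assms
  by (auto simp: matrix_factorization_def refined_mult_tensor_def kronecker_smult_one
      kronecker_mult[of _ a a _ a _ b b _ b])

text \<open>The recursion of \<open>diag_block_mat\<close> ends in an empty block; removing it gives
  a form to which block multiplication applies.\<close>

lemma diag_block_mat_pair:
  assumes "A \<in> carrier_mat m m" "B \<in> carrier_mat n n"
  shows "diag_block_mat [A, B] = four_block_mat A (0\<^sub>m m n) (0\<^sub>m n m) B"
  using assms by (auto simp: Let_def intro!: eq_matI)

text \<open>Both matrices consist of two diagonal copies of the refined product, so the refined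
  result applies to each copy and the size doubles.\<close>

lemma matrix_factorization_mult_tensor:
  fixes u v :: "'a :: comm_ring_1"
  assumes "matrix_factorization u a X" "matrix_factorization v b Y"
  shows "matrix_factorization (u * v) (2 * a * b) (mult_tensor X Y)"
proof -
  define P Q where "P = fst X \<otimes>\<^sub>K fst Y" and "Q = snd X \<otimes>\<^sub>K snd Y"
  have PQ: "P \<in> carrier_mat (a * b) (a * b)" "Q \<in> carrier_mat (a * b) (a * b)"
    "P * Q = (u * v) \<cdot>\<^sub>m 1\<^sub>m (a * b)" "Q * P = (u * v) \<cdot>\<^sub>m 1\<^sub>m (a * b)"
    using matrix_factorization_refined_mult_tensor[OF assms]
    by (auto simp: matrix_factorization_def refined_mult_tensor_def P_def Q_def)
  have zero: "0\<^sub>m (a * b) (a * b) \<in> carrier_mat (a * b) (a * b)" by simp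
  show ?thesis
    using PQ
    by (simp add: matrix_factorization_def mult_tensor_def diag_block_mat_pair[of _ "a * b" _ "a * b"]
        mult_four_block_mat[OF _ zero zero _ _ zero zero] four_block_smult_one mult_2 distrib_right
        flip: P_def Q_def del: diag_block_mat.simps)
qed


section \<open>The two algorithms\<close>

text \<open>The first monomial costs size 1 and each later one a doubling. Since
  \<open>foldl\<close> treats the last monomial last, the induction appends on the right.\<close>

lemma matrix_factorization_standard_method:
  assumes "ts \<noteq> []"
  shows "matrix_factorization (\<Sum>(a, b)\<leftarrow>ts. a * b) (2 ^ (length ts - 1)) (standard_method ts)"
  using assms
proof (induction ts rule: rev_nonempty_induct)
  case (single t)
  show ?case
    by (cases t) (auto simp: matrix_factorization_def standard_method_def scalar_prod_def intro!: eq_matI)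
next
  case (snoc t ts)
  obtain a b where t: "t = (a, b)" by fastforce
  have "standard_method (ts @ [t]) = standard_step (standard_method ts) t"
    using snoc.hyps by (simp add: standard_method_def)
  moreover have "2 ^ (length (ts @ [t]) - 1) = (2 :: nat) * 2 ^ (length ts - 1)"
    using snoc.hyps by (simp flip: power_Suc)
  ultimately show ?case
    using matrix_factorization_standard_step[OF snoc.IH, of a b] by (simp add: t)
qed

lemma combine_snoc: "xs \<noteq> [] \<Longrightarrow> combine op (xs @ [x]) = op (combine op xs) x"
  by (simp add: combine_def)

lemma combine_plus: "xs \<noteq> [] \<Longrightarrow> combine (+) xs = sum_list (xs :: 'a :: monoid_add list)"
  by (induction xs rule: rev_nonempty_induct) (simp_all add: combine_snoc, simp add: combine_def)

lemma combine_times: "xs \<noteq> [] \<Longrightarrow> combine (*) xs = prod_list (xs :: 'a :: monoid_mult list)"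
  by (induction xs rule: rev_nonempty_induct) (simp_all add: combine_snoc, simp add: combine_def)

text \<open>Here \<open>c\<close> is the extra factor paid per application of \<open>op\<close>, and
  a list of length \<open>k\<close> needs \<open>k - 1\<close> applications. One statement thus
  serves all three tensor products.\<close>

lemma matrix_factorization_combine:
  assumes op: "\<And>u v a b X Y. matrix_factorization u a X \<Longrightarrow> matrix_factorization v b Y
      \<Longrightarrow> matrix_factorization (op' u v) (c * a * b) (op X Y)"
    and "xs \<noteq> []" "\<And>x. x \<in> set xs \<Longrightarrow> matrix_factorization (F x) (N x) (M x)"
  shows "matrix_factorization (combine op' (map F xs))
    (c ^ (length xs - 1) * (\<Prod>x\<leftarrow>xs. N x)) (combine op (map M xs))"
  using assms(2,3)
proof (induction xs rule: rev_nonempty_induct)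
  case (single x)
  then show ?case by (simp add: combine_def)
next
  case (snoc x xs)
  have "c ^ (length (xs @ [x]) - 1) = c * c ^ (length xs - 1)"
    using snoc.hyps by (simp flip: power_Suc)
  then show ?case
    using op[OF snoc.IH snoc.prems[of x]] snoc.hyps snoc.prems
    by (simp add: combine_snoc mult.assoc)
qed

text \<open>With \<open>op\<close> and \<open>c\<close> left open, both algorithms are instances,
  and their sizes differ only in \<open>c\<close>.\<close>

lemma matrix_factorization_algorithm:
  fixes c :: nat
  assumes f: "summand_reduced f ts gs"
    and op: "\<And>u v a b X Y. matrix_factorization u a X \<Longrightarrow> matrix_factorization v b Y
      \<Longrightarrow> matrix_factorization (u * v) (c * a * b) (op X Y)"
  shows "matrix_factorization f
    ((if ts = [] then 1 else 2 ^ length ts) * 2 ^ (length gs - 1)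
      * (\<Prod>g\<leftarrow>gs. c ^ (length g - 1) * (\<Prod>h\<leftarrow>g. 2 ^ (length h - 1))))
    (factorization_algorithm op ts gs)"
proof -
  let ?N = "\<lambda>g. c ^ (length g - 1) * (\<Prod>h\<leftarrow>g. 2 ^ (length h - 1))"
  let ?CD = "combine yoshino_tensor (map (\<lambda>g. combine op (map standard_method g)) gs)"
  \<comment> \<open>On an empty list, \<open>combine\<close> and \<open>standard_method\<close>
    would start from an unspecified \<open>hd []\<close>.\<close>
  have "gs \<noteq> []" and ne: "\<And>g. g \<in> set gs \<Longrightarrow> g \<noteq> []" "\<And>g h. g \<in> set gs \<Longrightarrow> h \<in> set g \<Longrightarrow> h \<noteq> []"
    and f_eq: "f = split_sum_poly ts + (\<Sum>g\<leftarrow>gs. product_poly g)"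
    using f by (auto simp: summand_reduced_def split: if_splits)
  have "matrix_factorization (product_poly g) (?N g) (combine op (map standard_method g))"
    if "g \<in> set gs" for g
    using matrix_factorization_combine[of "(*)" c op g split_sum_poly
        "\<lambda>h. 2 ^ (length h - 1)" standard_method, OF op ne(1)[OF that]]
      matrix_factorization_standard_method[OF ne(2)[OF that]] ne(1)[OF that]
    by (simp add: product_poly_def combine_times flip: split_sum_poly_def)
  from matrix_factorization_combine[of "(+)" 2 yoshino_tensor gs product_poly ?N
      "\<lambda>g. combine op (map standard_method g)", OF matrix_factorization_yoshino_tensor \<open>gs \<noteq> []\<close> this]
  have CD: "matrix_factorization (\<Sum>g\<leftarrow>gs. product_poly g)
      (2 ^ (length gs - 1) * (\<Prod>g\<leftarrow>gs. ?N g)) ?CD"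
    using \<open>gs \<noteq> []\<close> by (simp add: combine_plus)
  show ?thesis
  proof (cases "ts = []")
    case True
    then show ?thesis
      using CD by (simp add: f_eq factorization_algorithm_def split_sum_poly_def)
  next
    case False
    \<comment> \<open>The additional factor 2 comes from the final Yoshino product that joins the
      two parts.\<close>
    then have "2 ^ length ts = (2 :: nat) * 2 ^ (length ts - 1)"
      by (simp flip: power_Suc)
    then show ?thesis
      using matrix_factorization_yoshino_tensor[OF matrix_factorization_standard_method[OF False] CD] False
      by (simp add: f_eq factorization_algorithm_def split_sum_poly_def mult.assoc)
  qed
qed

lemma prod_list_power_times:
  fixes c :: "'a :: comm_monoid_mult"
  assumes "\<And>g. g \<in> set gs \<Longrightarrow> g \<noteq> []"
  shows "(\<Prod>g\<leftarrow>gs. c ^ (length g - 1) * N g)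
    = c ^ ((\<Sum>g\<leftarrow>gs. length g) - length gs) * (\<Prod>g\<leftarrow>gs. N g)"
  using assms
proof (induction gs)
  case (Cons g gs)
  \<comment> \<open>This bound and the next keep the natural-number subtractions from being
    truncated.\<close>
  have "length gs \<le> (\<Sum>g\<leftarrow>gs. length g)"
    using sum_list_mono[of gs "\<lambda>_. 1" length] Cons.prems by (simp add: Suc_le_eq sum_list_triv)
  moreover have "1 \<le> length g"
    using Cons.prems by (simp add: Suc_le_eq)
  ultimately have "(\<Sum>g\<leftarrow>g # gs. length g) - length (g # gs)
      = (length g - 1) + ((\<Sum>g\<leftarrow>gs. length g) - length gs)"
    by simp
  then show ?case
    using Cons by (simp add: power_add ac_simps)
qed simp

theorem corollary4p2:
  fixes f :: "'n :: finite mpoly"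
    and ts :: "'n split_sum"
    and gs :: "'n split_sum list list"
  assumes "summand_reduced f ts gs"
  shows "matrix_factorization f (mf_size (refined_algorithm ts gs)) (refined_algorithm ts gs)
       \<and> matrix_factorization f (mf_size (improved_algorithm ts gs)) (improved_algorithm ts gs)
       \<and> mf_size (improved_algorithm ts gs)
           = 2 ^ ((\<Sum>g\<leftarrow>gs. length g) - length gs) * mf_size (refined_algorithm ts gs)"
proof -
  have ne: "\<And>g. g \<in> set gs \<Longrightarrow> g \<noteq> []"
    using assms by (auto simp: summand_reduced_def)
  \<comment> \<open>The power of \<open>1\<close> keeps the shape of the general size formula, here
    with \<open>c = 1\<close>.\<close>
  have refined: "matrix_factorization f
    ((if ts = [] then 1 else 2 ^ length ts) * 2 ^ (length gs - 1)
      * (\<Prod>g\<leftarrow>gs. 1 ^ (length g - 1) * (\<Prod>h\<leftarrow>g. 2 ^ (length h - 1))))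
    (refined_algorithm ts gs)"
    unfolding refined_algorithm_def
    by (rule matrix_factorization_algorithm[OF assms])
      (simp add: matrix_factorization_refined_mult_tensor)
  have improved: "matrix_factorization f
    ((if ts = [] then 1 else 2 ^ length ts) * 2 ^ (length gs - 1)
      * (\<Prod>g\<leftarrow>gs. 2 ^ (length g - 1) * (\<Prod>h\<leftarrow>g. 2 ^ (length h - 1))))
    (improved_algorithm ts gs)"
    unfolding improved_algorithm_def
    by (rule matrix_factorization_algorithm[OF assms matrix_factorization_mult_tensor])
  show ?thesis
    \<comment> \<open>Pulling the powers of 2 out of the improved size leaves exactly the refined
      size. Keeping \<open>1\<close> from becoming \<open>Suc 0\<close> lets
      \<open>prod_list_power_times\<close> match.\<close>
    using refined improved
    by (simp add: matrix_factorization_size[OF refined] matrix_factorization_size[OF improved]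
        prod_list_power_times[OF ne] del: One_nat_def)
qed

end
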